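(* Let $\mathscr{V}$ be a left skew-closed category, let $\mathscr{A}$ be a $\mathscr{V}$-category, let $K$ be an object of $\mathscr{A}$, and let $T:\mathscr{A}\to\mathscr{V}$ be a $\mathscr{V}$-functor. Then the function $$\mathscr{V}^{\mathscr{A}}(\mathscr{A}(K,-),T)\longrightarrow \mathscr{V}(I,TK),\qquad \theta\mapsto \theta_K\circ j_K,$$ from the set of $\mathscr{V}$-natural transformations $\theta:\mathscr{A}(K,-)\Rightarrow T$ to the set of morphisms $I\to TK$ in $\mathscr{V}$, where $j_K:I\to\mathscr{A}(K,K)$ is part of the structure of $\mathscr{A}$, is a bijection.
   Context: **Left skew-closed category.** A left skew-closed category $\mathscr{V}$ consists of a category $\mathscr{V}$, a functor $[-,-]:\mathscr{V}^{\mathrm{op}}\times\mathscr{V}\to\mathscr{V}$, an object $I$, and families of morphisms $i_A:[I,A]\to A$, $j_A:I\to[A,A]$, $L^A_{B,C}:[B,C]\to[[A,B],[A,C]]$. Here $i_A$ is natural in $A$; $j$ is (extraordinary) natural in $A$, i.e. $[f,1]j_B=[1,f]j_A$ for $f:A\to B$; $L^A_{B,C}$ is natural in $B,C$ and (extraordinary) natural in $A$, i.e. $[1,[f,1]]L^{A'}_{B,C}=[[f,1],1]L^A_{B,C}$ for $f:A\to A'$. The axioms are: 1. $[L^A_{B,C},1]\,L^{[A,B]}_{[A,C],[A,D]}\,L^A_{C,D}=[1,L^A_{B,D}]\,L^B_{C,D}:[C,D]\to[[B,C],[[A,B],[A,D]]]$; 2. $i_{[A,C]}\,[j_A,1]\,L^A_{A,C}=1_{[A,C]}$;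 3. $L^A_{B,B}\,j_B=j_{[A,B]}$; 4. $[1,i_C]\,L^I_{B,C}=[i_B,1]:[B,C]\to[[I,B],C]$; 5. $i_I\,j_I=1_I$. No invertibility of $i$, $j$, $L$ is assumed. $\mathscr{V}(X,Y)$ denotes the hom set of the category $\mathscr{V}$. **$\mathscr{V}$-category.** A $\mathscr{V}$-category $\mathscr{A}$ consists of a set $\mathrm{ob}\mathscr{A}$ of objects, an object $\mathscr{A}(A,B)$ of $\mathscr{V}$ for all objects $A,B$, morphisms $j_A:I\to\mathscr{A}(A,A)$, and morphisms $L^A_{B,C}:\mathscr{A}(B,C)\to[\mathscr{A}(A,B),\mathscr{A}(A,C)]$ in $\mathscr{V}$, such that - $[L^A_{B,C},1]\,L^{\mathscr{A}(A,B)}_{\mathscr{A}(A,C),\mathscr{A}(A,D)}\,L^A_{C,D}=[1,L^A_{B,D}]\,L^B_{C,D}:\mathscr{A}(C,D)\to[\mathscr{A}(B,C),[\mathscr{A}(A,B),\mathscr{A}(A,D)]]$; - $i_{\mathscr{A}(A,C)}\,[j_A,1]\,L^A_{A,C}=1_{\mathscr{A}(A,C)}$; - $L^A_{B,B}\,j_B=j_{\mathscr{A}(A,B)}$. (In these, $L$ with superscript an object of $\mathscr{V}$ is that of $\mathscr{V}$; likewise for $j$ with subscript an object of $\mathscr{V}$.) $\mathscr{V}$ itself is a $\mathscr{V}$-category with homs $[A,B]$ and its own $j$, $L$. **$\mathscr{V}$-functor.** A $\mathscr{V}$-functor $T:\mathscr{A}\to\mathscr{X}$ consists of a function $T:\mathrm{ob}\mathscr{A}\to\mathrm{ob}\mathscr{X}$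 and morphisms $T_{A,B}:\mathscr{A}(A,B)\to\mathscr{X}(TA,TB)$ in $\mathscr{V}$ such that $[T_{B,A},1]\,L^{TB}_{TA,TC}\,T_{A,C}=[1,T_{B,C}]\,L^B_{A,C}:\mathscr{A}(A,C)\to[\mathscr{A}(B,A),\mathscr{X}(TB,TC)]$ and $T_{A,A}\,j_A=j_{TA}$. For an object $K$ of $\mathscr{A}$, the representable $\mathscr{V}$-functor $\mathscr{A}(K,-):\mathscr{A}\to\mathscr{V}$ takes $A$ to $\mathscr{A}(K,A)$ and has effect on homs $L^K_{A,B}:\mathscr{A}(A,B)\to[\mathscr{A}(K,A),\mathscr{A}(K,B)]$. **$\mathscr{V}$-natural transformation.** For $\mathscr{V}$-functors $S,T:\mathscr{A}\to\mathscr{V}$, a $\mathscr{V}$-natural transformation $\theta:S\Rightarrow T$ is a family of morphisms $\theta_A:SA\to TA$ in $\mathscr{V}$ such that $[1,\theta_B]\,S_{A,B}=[\theta_A,1]\,T_{A,B}:\mathscr{A}(A,B)\to[SA,TB]$ for all objects $A,B$. $\mathscr{V}^{\mathscr{A}}$ is the category of $\mathscr{V}$-functors $\mathscr{A}\to\mathscr{V}$ and $\mathscr{V}$-natural transformations. *)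

theory Defs
  imports "HOL-Library.FuncSet"
begin

record ('o, 'm) cat =
  Ob :: "'o set"
  Arr :: "'m set"
  Dom :: "'m \<Rightarrow> 'o"
  Cod :: "'m \<Rightarrow> 'o"
  Id :: "'o \<Rightarrow> 'm"
  Comp :: "'m \<Rightarrow> 'm \<Rightarrow> 'm"  (infixr "\<cdot>\<index>" 55)

definition hom :: "('o, 'm, 'z) cat_scheme \<Rightarrow> 'o \<Rightarrow> 'o \<Rightarrow> 'm set" where
  "hom C a b = {f \<in> Arr C. Dom C f = a \<and> Cod C f = b}"

locale category =
  fixes C :: "('o, 'm, 'z) cat_scheme" (structure)
  assumes dom_in_Ob: "f \<in> Arr C \<Longrightarrow> Dom C f \<in> Ob C"
    and cod_in_Ob: "f \<in> Arr C \<Longrightarrow> Cod C f \<in> Ob C"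
    and Id_in_hom: "a \<in> Ob C \<Longrightarrow> Id C a \<in> hom C a a"
    and comp_in_hom: "f \<in> hom C a b \<Longrightarrow> g \<in> hom C b c \<Longrightarrow> g \<cdot> f \<in> hom C a c"
    and comp_Id_left: "f \<in> hom C a b \<Longrightarrow> Id C b \<cdot> f = f"
    and comp_Id_right: "f \<in> hom C a b \<Longrightarrow> f \<cdot> Id C a = f"
    and comp_assoc: "f \<in> hom C a b \<Longrightarrow> g \<in> hom C b c \<Longrightarrow> h \<in> hom C c d
      \<Longrightarrow> (h \<cdot> g) \<cdot> f = h \<cdot> (g \<cdot> f)"

(* ihom V a b is the object [a,b] and imap V f g is the arrow [f,g], contravariant in f.
   The superscript of L is the first argument: Lmap V a b c : [b,c] -> [[a,b],[a,c]]. *)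
record ('o, 'm) skew_closed_cat = "('o, 'm) cat" +
  ihom :: "'o \<Rightarrow> 'o \<Rightarrow> 'o"
  imap :: "'m \<Rightarrow> 'm \<Rightarrow> 'm"
  unit_ob :: "'o"
  imor :: "'o \<Rightarrow> 'm"
  jmor :: "'o \<Rightarrow> 'm"
  Lmap :: "'o \<Rightarrow> 'o \<Rightarrow> 'o \<Rightarrow> 'm"

locale left_skew_closed_category = category V
  for V :: "('o, 'm) skew_closed_cat" (structure) +
  assumes ihom_Ob: "a \<in> Ob V \<Longrightarrow> b \<in> Ob V \<Longrightarrow> ihom V a b \<in> Ob V"
    and imap_in_hom: "f \<in> hom V a' a \<Longrightarrow> g \<in> hom V b b'
      \<Longrightarrow> imap V f g \<in> hom V (ihom V a b) (ihom V a' b')"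
    and imap_Id: "a \<in> Ob V \<Longrightarrow> b \<in> Ob V \<Longrightarrow> imap V (Id V a) (Id V b) = Id V (ihom V a b)"
    and imap_comp: "f \<in> hom V a' a \<Longrightarrow> f' \<in> hom V a'' a' \<Longrightarrow> g \<in> hom V b b' \<Longrightarrow> g' \<in> hom V b' b''
      \<Longrightarrow> imap V (f \<cdot> f') (g' \<cdot> g) = imap V f' g' \<cdot> imap V f g"
    and unit_Ob: "unit_ob V \<in> Ob V"
    and imor_in_hom: "a \<in> Ob V \<Longrightarrow> imor V a \<in> hom V (ihom V (unit_ob V) a) a"
    and jmor_in_hom: "a \<in> Ob V \<Longrightarrow> jmor V a \<in> hom V (unit_ob V) (ihom V a a)"
    and Lmap_in_hom: "a \<in> Ob V \<Longrightarrow> b \<in> Ob V \<Longrightarrow> c \<in> Ob V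
      \<Longrightarrow> Lmap V a b c \<in> hom V (ihom V b c) (ihom V (ihom V a b) (ihom V a c))"
    and imor_natural: "f \<in> hom V a b
      \<Longrightarrow> imor V b \<cdot> imap V (Id V (unit_ob V)) f = f \<cdot> imor V a"
    and jmor_natural: "f \<in> hom V a b
      \<Longrightarrow> imap V f (Id V b) \<cdot> jmor V b = imap V (Id V a) f \<cdot> jmor V a"
    and Lmap_natural: "a \<in> Ob V \<Longrightarrow> g \<in> hom V b' b \<Longrightarrow> h \<in> hom V c c'
      \<Longrightarrow> Lmap V a b' c' \<cdot> imap V g h
         = imap V (imap V (Id V a) g) (imap V (Id V a) h) \<cdot> Lmap V a b c"
    and Lmap_extranatural: "f \<in> hom V a a' \<Longrightarrow> b \<in> Ob V \<Longrightarrow> c \<in> Ob V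
      \<Longrightarrow> imap V (Id V (ihom V a' b)) (imap V f (Id V c)) \<cdot> Lmap V a' b c
         = imap V (imap V f (Id V b)) (Id V (ihom V a c)) \<cdot> Lmap V a b c"
    and Lmap_Lmap: "a \<in> Ob V \<Longrightarrow> b \<in> Ob V \<Longrightarrow> c \<in> Ob V \<Longrightarrow> d \<in> Ob V
      \<Longrightarrow> imap V (Lmap V a b c) (Id V (ihom V (ihom V a b) (ihom V a d)))
           \<cdot> Lmap V (ihom V a b) (ihom V a c) (ihom V a d) \<cdot> Lmap V a c d
         = imap V (Id V (ihom V b c)) (Lmap V a b d) \<cdot> Lmap V b c d"
    and imor_jmor_Lmap: "a \<in> Ob V \<Longrightarrow> c \<in> Ob V
      \<Longrightarrow> imor V (ihom V a c) \<cdot> imap V (jmor V a) (Id V (ihom V a c)) \<cdot> Lmap V a a c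
         = Id V (ihom V a c)"
    and Lmap_jmor: "a \<in> Ob V \<Longrightarrow> b \<in> Ob V
      \<Longrightarrow> Lmap V a b b \<cdot> jmor V b = jmor V (ihom V a b)"
    and imor_Lmap: "b \<in> Ob V \<Longrightarrow> c \<in> Ob V
      \<Longrightarrow> imap V (Id V (ihom V (unit_ob V) b)) (imor V c) \<cdot> Lmap V (unit_ob V) b c
         = imap V (imor V b) (Id V c)"
    and imor_jmor: "imor V (unit_ob V) \<cdot> jmor V (unit_ob V) = Id V (unit_ob V)"

record ('a, 'o, 'm) enriched_cat =
  EOb :: "'a set"
  EHom :: "'a \<Rightarrow> 'a \<Rightarrow> 'o"
  Ej :: "'a \<Rightarrow> 'm"
  EL :: "'a \<Rightarrow> 'a \<Rightarrow> 'a \<Rightarrow> 'm"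

locale enriched_category = left_skew_closed_category V
  for V :: "('o, 'm) skew_closed_cat" (structure)
    and A :: "('a, 'o, 'm) enriched_cat" +
  assumes EHom_Ob: "a \<in> EOb A \<Longrightarrow> b \<in> EOb A \<Longrightarrow> EHom A a b \<in> Ob V"
    and Ej_in_hom: "a \<in> EOb A \<Longrightarrow> Ej A a \<in> hom V (unit_ob V) (EHom A a a)"
    and EL_in_hom: "a \<in> EOb A \<Longrightarrow> b \<in> EOb A \<Longrightarrow> c \<in> EOb A
      \<Longrightarrow> EL A a b c \<in> hom V (EHom A b c) (ihom V (EHom A a b) (EHom A a c))"
    and EL_EL: "a \<in> EOb A \<Longrightarrow> b \<in> EOb A \<Longrightarrow> c \<in> EOb A \<Longrightarrow> d \<in> EOb A
      \<Longrightarrow> imap V (EL A a b c) (Id V (ihom V (EHom A a b) (EHom A a d)))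
           \<cdot> Lmap V (EHom A a b) (EHom A a c) (EHom A a d) \<cdot> EL A a c d
         = imap V (Id V (EHom A b c)) (EL A a b d) \<cdot> EL A b c d"
    and imor_Ej_EL: "a \<in> EOb A \<Longrightarrow> c \<in> EOb A
      \<Longrightarrow> imor V (EHom A a c) \<cdot> imap V (Ej A a) (Id V (EHom A a c)) \<cdot> EL A a a c
         = Id V (EHom A a c)"
    and EL_Ej: "a \<in> EOb A \<Longrightarrow> b \<in> EOb A
      \<Longrightarrow> EL A a b b \<cdot> Ej A b = jmor V (EHom A a b)"

definition self_enriched :: "('o, 'm) skew_closed_cat \<Rightarrow> ('o, 'o, 'm) enriched_cat" where
  "self_enriched V = \<lparr>EOb = Ob V, EHom = ihom V, Ej = jmor V, EL = Lmap V\<rparr>"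

record ('a, 'x, 'm) enriched_fun =
  FOb :: "'a \<Rightarrow> 'x"
  FMor :: "'a \<Rightarrow> 'a \<Rightarrow> 'm"

locale enriched_functor =
  A: enriched_category V A + X: enriched_category V X
  for V :: "('o, 'm) skew_closed_cat" (structure)
    and A :: "('a, 'o, 'm) enriched_cat"
    and X :: "('x, 'o, 'm) enriched_cat"
    and T :: "('a, 'x, 'm) enriched_fun" +
  assumes FOb_EOb: "a \<in> EOb A \<Longrightarrow> FOb T a \<in> EOb X"
    and FMor_in_hom: "a \<in> EOb A \<Longrightarrow> b \<in> EOb A
      \<Longrightarrow> FMor T a b \<in> hom V (EHom A a b) (EHom X (FOb T a) (FOb T b))"
    and FMor_EL: "a \<in> EOb A \<Longrightarrow> b \<in> EOb A \<Longrightarrow> c \<in> EOb A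
      \<Longrightarrow> imap V (FMor T b a) (Id V (EHom X (FOb T b) (FOb T c)))
           \<cdot> EL X (FOb T b) (FOb T a) (FOb T c) \<cdot> FMor T a c
         = imap V (Id V (EHom A b a)) (FMor T b c) \<cdot> EL A b a c"
    and FMor_Ej: "a \<in> EOb A \<Longrightarrow> FMor T a a \<cdot> Ej A a = Ej X (FOb T a)"

definition representable :: "('a, 'o, 'm) enriched_cat \<Rightarrow> 'a \<Rightarrow> ('a, 'o, 'm) enriched_fun" where
  "representable A k = \<lparr>FOb = EHom A k, FMor = EL A k\<rparr>"

(* Components outside the objects of A are pinned to undefined by PiE, so that equality of
   elements of this set is equality of families indexed by the objects of A. *)
definition enriched_nat_trans ::
  "('o, 'm) skew_closed_cat \<Rightarrow> ('a, 'o, 'm) enriched_cat \<Rightarrow> ('a, 'o, 'm) enriched_fun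
    \<Rightarrow> ('a, 'o, 'm) enriched_fun \<Rightarrow> ('a \<Rightarrow> 'm) set" where
  "enriched_nat_trans V A S T =
    {\<theta> \<in> (\<Pi>\<^sub>E a\<in>EOb A. hom V (FOb S a) (FOb T a)).
      \<forall>a\<in>EOb A. \<forall>b\<in>EOb A.
        imap V (Id V (FOb S a)) (\<theta> b) \<cdot>\<^bsub>V\<^esub> FMor S a b
        = imap V (\<theta> a) (Id V (FOb T b)) \<cdot>\<^bsub>V\<^esub> FMor T a b}"

lemma (in left_skew_closed_category) self_enriched_category:
  "enriched_category V (self_enriched V)"
  by unfold_locales
    (simp_all add: self_enriched_def ihom_Ob jmor_in_hom Lmap_in_hom Lmap_Lmap imor_jmor_Lmap Lmap_jmor)

lemma (in enriched_category) representable_enriched_functor: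
  assumes "k \<in> EOb A"
  shows "enriched_functor V A (self_enriched V) (representable A k)"
proof -
  interpret S: enriched_category V "self_enriched V" by (rule self_enriched_category)
  show ?thesis
    by unfold_locales
      (simp_all add: assms representable_def self_enriched_def EHom_Ob EL_in_hom EL_EL EL_Ej)
qed

end

theory Submission
  imports Defs
begin

text \<open>
  This is the weak Yoneda lemma, and the proof is the classical one: a transformation \<open>\<theta>\<close> out of a
  representable is recovered from the element \<open>x = \<theta>\<^sub>K \<circ> j\<^sub>K\<close> by letting a hom object act through \<open>T\<close>
  and then evaluating at \<open>x\<close>. In a left skew-closed category an element \<open>x : I \<rightarrow> c\<close> gives an evaluation
  \<open>ev\<^sub>x = i\<^sub>b \<circ> [x,1] : [c,b] \<rightarrow> b\<close>, so the candidate inverse sends \<open>x\<close> to the family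
  \<open>ev\<^sub>x \<circ> T\<^sub>K\<^sub>a : A(K,a) \<rightarrow> T a\<close>.

  All coherence that is needed is packed into facts about \<open>ev\<^sub>x\<close>. It is natural in \<open>b\<close>
  (\<open>eval_at_natural\<close>) and satisfies \<open>ev\<^sub>t\<^sub>x = ev\<^sub>x \<circ> [t,1]\<close> (\<open>eval_at_comp\<close>); together with
  the unit law of \<open>A\<close>, which says that evaluating \<open>L\<^sup>K\<close> at \<open>j\<^sub>K\<close> is the identity, this shows that
  \<open>\<theta>\<close> is determined by \<open>x\<close>. Evaluating \<open>j\<^sub>c\<close> at \<open>x\<close> returns \<open>x\<close> (\<open>eval_at_jmor\<close>), and since \<open>T\<close>
  preserves \<open>j\<close>, the family built from \<open>x\<close> has \<open>x\<close> as its element. Finally \<open>[1,ev\<^sub>x] \<circ> L = [ev\<^sub>x,1]\<close>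
  (\<open>eval_at_Lmap\<close>), which together with the functor law for \<open>T\<close> is the \<open>V\<close>-naturality of that family.
\<close>

section \<open>Evaluation at an element\<close>

definition eval_at :: "('o, 'm) skew_closed_cat \<Rightarrow> 'm \<Rightarrow> 'o \<Rightarrow> 'm" where
  "eval_at V x b = imor V b \<cdot>\<^bsub>V\<^esub> imap V x (Id V b)"

context category
begin

lemma hom_ObD:
  assumes "f \<in> hom C a b"
  shows "a \<in> Ob C" "b \<in> Ob C"
  using assms dom_in_Ob cod_in_Ob by (auto simp: hom_def)

end

context left_skew_closed_category
begin

lemma imap_Id_comp:
  assumes "a \<in> Ob V" "f \<in> hom V b c" "g \<in> hom V c d"
  shows "imap V (Id V a) (g \<cdot> f) = imap V (Id V a) g \<cdot> imap V (Id V a) f"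
  using imap_comp[of "Id V a" a a "Id V a" a f b c g d] assms
  by (simp add: Id_in_hom comp_Id_left[OF Id_in_hom])

lemma imap_comp_Id:
  assumes "d \<in> Ob V" "f \<in> hom V a b" "g \<in> hom V b c"
  shows "imap V (g \<cdot> f) (Id V d) = imap V f (Id V d) \<cdot> imap V g (Id V d)"
  using imap_comp[of g b c f a "Id V d" d d "Id V d" d] assms
  by (simp add: Id_in_hom comp_Id_left[OF Id_in_hom])

lemma imap_interchange:
  assumes f: "f \<in> hom V a' a" and g: "g \<in> hom V b b'"
  shows "imap V (Id V a') g \<cdot> imap V f (Id V b) = imap V f (Id V b') \<cdot> imap V (Id V a) g"
proof -
  note Obs = hom_ObD[OF f] hom_ObD[OF g]
  have "imap V (Id V a') g \<cdot> imap V f (Id V b) = imap V f g"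
    using imap_comp[OF f Id_in_hom Id_in_hom g] f g Obs
    by (simp add: comp_Id_right)
  also have "\<dots> = imap V f (Id V b') \<cdot> imap V (Id V a) g"
    using imap_comp[OF Id_in_hom f g Id_in_hom] f g Obs
    by (simp add: comp_Id_left)
  finally show ?thesis .
qed

lemma eval_at_in_hom:
  assumes "x \<in> hom V (unit_ob V) c" "b \<in> Ob V"
  shows "eval_at V x b \<in> hom V (ihom V c b) b"
  unfolding eval_at_def
  by (rule assms comp_in_hom imap_in_hom Id_in_hom imor_in_hom)+

lemma eval_at_natural:
  assumes x: "x \<in> hom V (unit_ob V) c" and g: "g \<in> hom V b b'"
  shows "eval_at V x b' \<cdot> imap V (Id V c) g = g \<cdot> eval_at V x b"
proof -
  let ?I = "unit_ob V"
  note Obs = hom_ObD[OF x] hom_ObD[OF g]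
  note homs = x g Obs Id_in_hom imap_in_hom imor_in_hom
  have "eval_at V x b' \<cdot> imap V (Id V c) g
      = imor V b' \<cdot> (imap V x (Id V b') \<cdot> imap V (Id V c) g)"
    unfolding eval_at_def by (rule comp_assoc, (rule homs)+)
  also have "\<dots> = imor V b' \<cdot> (imap V (Id V ?I) g \<cdot> imap V x (Id V b))"
    by (simp add: imap_interchange[OF x g])
  also have "\<dots> = (imor V b' \<cdot> imap V (Id V ?I) g) \<cdot> imap V x (Id V b)"
    by (rule comp_assoc[symmetric], (rule homs)+)
  also have "\<dots> = (g \<cdot> imor V b) \<cdot> imap V x (Id V b)"
    by (simp add: imor_natural[OF g])
  also have "\<dots> = g \<cdot> eval_at V x b"
    unfolding eval_at_def by (rule comp_assoc, (rule homs)+)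
  finally show ?thesis .
qed

lemma eval_at_comp:
  assumes x: "x \<in> hom V (unit_ob V) c" and y: "y \<in> hom V c d" and b: "b \<in> Ob V"
  shows "eval_at V (y \<cdot> x) b = eval_at V x b \<cdot> imap V y (Id V b)"
proof -
  have "eval_at V (y \<cdot> x) b = imor V b \<cdot> (imap V x (Id V b) \<cdot> imap V y (Id V b))"
    by (simp add: eval_at_def imap_comp_Id[OF b x y])
  also have "\<dots> = eval_at V x b \<cdot> imap V y (Id V b)"
    unfolding eval_at_def
    by (rule comp_assoc[symmetric], (rule x y b Id_in_hom imap_in_hom imor_in_hom)+)
  finally show ?thesis .
qed

text \<open>
  Extraordinary naturality of \<open>j\<close> moves \<open>x\<close> from the contravariant to the covariant argument, and
  naturality of \<open>i\<close> moves it outside; what remains is \<open>i\<^sub>I \<circ> j\<^sub>I = 1\<close>.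
\<close>

lemma eval_at_jmor:
  assumes x: "x \<in> hom V (unit_ob V) c"
  shows "eval_at V x c \<cdot> jmor V c = x"
proof -
  let ?I = "unit_ob V"
  note Obs = hom_ObD[OF x]
  note homs = x Obs Id_in_hom imap_in_hom imor_in_hom jmor_in_hom
  have "eval_at V x c \<cdot> jmor V c = imor V c \<cdot> (imap V x (Id V c) \<cdot> jmor V c)"
    unfolding eval_at_def by (rule comp_assoc, (rule homs)+)
  also have "\<dots> = imor V c \<cdot> (imap V (Id V ?I) x \<cdot> jmor V ?I)"
    by (simp add: jmor_natural[OF x])
  also have "\<dots> = (imor V c \<cdot> imap V (Id V ?I) x) \<cdot> jmor V ?I"
    by (rule comp_assoc[symmetric], (rule homs)+)
  also have "\<dots> = (x \<cdot> imor V ?I) \<cdot> jmor V ?I"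
    by (simp add: imor_natural[OF x])
  also have "\<dots> = x \<cdot> (imor V ?I \<cdot> jmor V ?I)"
    by (rule comp_assoc, (rule homs)+)
  also have "\<dots> = x"
    using x by (simp add: imor_jmor comp_Id_right)
  finally show ?thesis .
qed

text \<open>
  Internally, this says that for \<open>g : b \<rightarrow> c\<close> postcomposing an arrow \<open>a \<rightarrow> b\<close> with \<open>g\<close> and evaluating at
  \<open>x\<close> is the same as evaluating at \<open>x\<close> and applying \<open>g\<close>. Extraordinary naturality of \<open>L\<close> in its
  superscript reduces a general \<open>x\<close> to the case \<open>x = 1\<^sub>I\<close>, which is the axiom
  \<open>[1,i] \<circ> L\<^sup>I = [i,1]\<close>.
\<close>

lemma eval_at_Lmap:
  assumes x: "x \<in> hom V (unit_ob V) a" and b: "b \<in> Ob V" and c: "c \<in> Ob V"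
  shows "imap V (Id V (ihom V a b)) (eval_at V x c) \<cdot> Lmap V a b c
    = imap V (eval_at V x b) (Id V c)"
proof -
  let ?I = "unit_ob V" and ?xb = "imap V x (Id V b)" and ?xc = "imap V x (Id V c)"
  note a = hom_ObD(2)[OF x]
  have xb: "?xb \<in> hom V (ihom V a b) (ihom V ?I b)"
    and xc: "?xc \<in> hom V (ihom V a c) (ihom V ?I c)"
    by (rule x b c imap_in_hom Id_in_hom)+
  note homs = xb xc a b c unit_Ob Id_in_hom imap_in_hom imor_in_hom Lmap_in_hom ihom_Ob
  have "imap V (Id V (ihom V a b)) (eval_at V x c) \<cdot> Lmap V a b c
      = (imap V (Id V (ihom V a b)) (imor V c) \<cdot> imap V (Id V (ihom V a b)) ?xc) \<cdot> Lmap V a b c"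
    using imap_Id_comp[OF ihom_Ob[OF a b] xc imor_in_hom[OF c]] by (simp add: eval_at_def)
  also have "\<dots> = imap V (Id V (ihom V a b)) (imor V c)
      \<cdot> (imap V (Id V (ihom V a b)) ?xc \<cdot> Lmap V a b c)"
    by (rule comp_assoc, (rule homs)+)
  also have "\<dots> = imap V (Id V (ihom V a b)) (imor V c)
      \<cdot> (imap V ?xb (Id V (ihom V ?I c)) \<cdot> Lmap V ?I b c)"
    by (simp add: Lmap_extranatural[OF x b c])
  also have "\<dots> = (imap V (Id V (ihom V a b)) (imor V c) \<cdot> imap V ?xb (Id V (ihom V ?I c)))
      \<cdot> Lmap V ?I b c"
    by (rule comp_assoc[symmetric], (rule homs)+)
  also have "\<dots> = (imap V ?xb (Id V c) \<cdot> imap V (Id V (ihom V ?I b)) (imor V c)) \<cdot> Lmap V ?I b c"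
    by (simp add: imap_interchange[OF xb imor_in_hom[OF c]])
  also have "\<dots> = imap V ?xb (Id V c) \<cdot> (imap V (Id V (ihom V ?I b)) (imor V c) \<cdot> Lmap V ?I b c)"
    by (rule comp_assoc, (rule homs)+)
  also have "\<dots> = imap V ?xb (Id V c) \<cdot> imap V (imor V b) (Id V c)"
    by (simp add: imor_Lmap[OF b c])
  also have "\<dots> = imap V (eval_at V x b) (Id V c)"
    using imap_comp_Id[OF c xb imor_in_hom[OF b]] by (simp add: eval_at_def)
  finally show ?thesis .
qed

end

lemma (in enriched_category) eval_at_Ej_EL:
  assumes k: "k \<in> EOb A" and a: "a \<in> EOb A"
  shows "eval_at V (Ej A k) (EHom A k a) \<cdot> EL A k k a = Id V (EHom A k a)"
proof -
  have "eval_at V (Ej A k) (EHom A k a) \<cdot> EL A k k a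
      = imor V (EHom A k a) \<cdot> (imap V (Ej A k) (Id V (EHom A k a)) \<cdot> EL A k k a)"
    unfolding eval_at_def
    by (rule comp_assoc, (rule k a EHom_Ob Ej_in_hom EL_in_hom Id_in_hom imap_in_hom imor_in_hom)+)
  then show ?thesis
    by (simp add: imor_Ej_EL[OF k a])
qed

section \<open>Transformations out of a representable\<close>

locale enriched_functor_to_base =
  enriched_functor V A "self_enriched V" T
  for V :: "('o, 'm) skew_closed_cat" (structure)
    and A :: "('a, 'o, 'm) enriched_cat"
    and T :: "('a, 'o, 'm) enriched_fun"
begin

lemma FOb_Ob: "a \<in> EOb A \<Longrightarrow> FOb T a \<in> Ob V"
  using FOb_EOb by (simp add: self_enriched_def)

lemma FMor_in_ihom:
  "a \<in> EOb A \<Longrightarrow> b \<in> EOb A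
    \<Longrightarrow> FMor T a b \<in> hom V (EHom A a b) (ihom V (FOb T a) (FOb T b))"
  using FMor_in_hom by (simp add: self_enriched_def)

lemma FMor_Lmap:
  "a \<in> EOb A \<Longrightarrow> b \<in> EOb A \<Longrightarrow> c \<in> EOb A
    \<Longrightarrow> imap V (FMor T b a) (Id V (ihom V (FOb T b) (FOb T c)))
         \<cdot> Lmap V (FOb T b) (FOb T a) (FOb T c) \<cdot> FMor T a c
       = imap V (Id V (EHom A b a)) (FMor T b c) \<cdot> EL A b a c"
  using FMor_EL by (simp add: self_enriched_def)

lemma FMor_jmor: "a \<in> EOb A \<Longrightarrow> FMor T a a \<cdot> Ej A a = jmor V (FOb T a)"
  using FMor_Ej by (simp add: self_enriched_def)

definition yoneda_component :: "'a \<Rightarrow> 'm \<Rightarrow> 'a \<Rightarrow> 'm" where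
  "yoneda_component k x a = eval_at V x (FOb T a) \<cdot> FMor T k a"

lemma yoneda_component_in_hom:
  assumes "k \<in> EOb A" "a \<in> EOb A" "x \<in> hom V (unit_ob V) (FOb T k)"
  shows "yoneda_component k x a \<in> hom V (EHom A k a) (FOb T a)"
  unfolding yoneda_component_def
  by (rule A.comp_in_hom, (rule assms A.eval_at_in_hom FMor_in_ihom FOb_Ob)+)

lemma yoneda_component_Ej:
  assumes k: "k \<in> EOb A" and x: "x \<in> hom V (unit_ob V) (FOb T k)"
  shows "yoneda_component k x k \<cdot> Ej A k = x"
proof -
  have "yoneda_component k x k \<cdot> Ej A k = eval_at V x (FOb T k) \<cdot> (FMor T k k \<cdot> Ej A k)"
    unfolding yoneda_component_def
    by (rule A.comp_assoc, (rule k x A.Ej_in_hom FMor_in_ihom A.eval_at_in_hom FOb_Ob)+)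
  then show ?thesis
    by (simp add: FMor_jmor[OF k] A.eval_at_jmor[OF x])
qed

text \<open>
  The functor law rewrites \<open>[1,T\<^sub>k\<^sub>b] \<circ> L\<^sup>k\<close> in terms of the \<open>L\<close> of \<open>V\<close>, on which \<open>eval_at_Lmap\<close> turns
  the covariant evaluation into a contravariant one.
\<close>

lemma yoneda_component_natural:
  assumes k: "k \<in> EOb A" and a: "a \<in> EOb A" and b: "b \<in> EOb A"
    and x: "x \<in> hom V (unit_ob V) (FOb T k)"
  shows "imap V (Id V (EHom A k a)) (yoneda_component k x b) \<cdot> EL A k a b
    = imap V (yoneda_component k x a) (Id V (FOb T b)) \<cdot> FMor T a b"
proof -
  let ?H = "EHom A k a" and ?Ta = "FOb T a" and ?Tb = "FOb T b" and ?Tk = "FOb T k"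
  let ?ea = "eval_at V x ?Ta" and ?eb = "eval_at V x ?Tb"
  let ?L = "Lmap V ?Tk ?Ta ?Tb"
  have obs: "?H \<in> Ob V" "?Ta \<in> Ob V" "?Tb \<in> Ob V" "?Tk \<in> Ob V"
    "ihom V ?Tk ?Ta \<in> Ob V" "ihom V ?Tk ?Tb \<in> Ob V"
    by (rule k a b A.EHom_Ob FOb_Ob A.ihom_Ob)+
  have Tka: "FMor T k a \<in> hom V ?H (ihom V ?Tk ?Ta)"
    and Tkb: "FMor T k b \<in> hom V (EHom A k b) (ihom V ?Tk ?Tb)"
    and Tab: "FMor T a b \<in> hom V (EHom A a b) (ihom V ?Ta ?Tb)"
    by (rule k a b FMor_in_ihom)+
  have ea: "?ea \<in> hom V (ihom V ?Tk ?Ta) ?Ta" and eb: "?eb \<in> hom V (ihom V ?Tk ?Tb) ?Tb"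
    by (rule x obs A.eval_at_in_hom)+
  have L: "?L \<in> hom V (ihom V ?Ta ?Tb) (ihom V (ihom V ?Tk ?Ta) (ihom V ?Tk ?Tb))"
    by (rule obs A.Lmap_in_hom)+
  note LT = A.comp_in_hom[OF Tab L]
  have EL: "EL A k a b \<in> hom V (EHom A a b) (ihom V ?H (EHom A k b))"
    by (rule k a b A.EL_in_hom)+
  note homs = obs Tka Tkb Tab ea eb L LT EL A.Id_in_hom A.imap_in_hom
  have "imap V (Id V ?H) (yoneda_component k x b) \<cdot> EL A k a b
      = (imap V (Id V ?H) ?eb \<cdot> imap V (Id V ?H) (FMor T k b)) \<cdot> EL A k a b"
    by (simp add: yoneda_component_def A.imap_Id_comp[OF obs(1) Tkb eb])
  also have "\<dots> = imap V (Id V ?H) ?eb \<cdot> (imap V (Id V ?H) (FMor T k b) \<cdot> EL A k a b)"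
    by (rule A.comp_assoc, (rule homs)+)
  also have "\<dots> = imap V (Id V ?H) ?eb
      \<cdot> (imap V (FMor T k a) (Id V (ihom V ?Tk ?Tb)) \<cdot> (?L \<cdot> FMor T a b))"
    by (simp add: FMor_Lmap[OF a k b])
  also have "\<dots> = (imap V (Id V ?H) ?eb \<cdot> imap V (FMor T k a) (Id V (ihom V ?Tk ?Tb)))
      \<cdot> (?L \<cdot> FMor T a b)"
    by (rule A.comp_assoc[symmetric], (rule homs)+)
  also have "\<dots> = (imap V (FMor T k a) (Id V ?Tb) \<cdot> imap V (Id V (ihom V ?Tk ?Ta)) ?eb)
      \<cdot> (?L \<cdot> FMor T a b)"
    by (simp add: A.imap_interchange[OF Tka eb])
  also have "\<dots> = imap V (FMor T k a) (Id V ?Tb)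
      \<cdot> (imap V (Id V (ihom V ?Tk ?Ta)) ?eb \<cdot> (?L \<cdot> FMor T a b))"
    by (rule A.comp_assoc, (rule homs)+)
  also have "imap V (Id V (ihom V ?Tk ?Ta)) ?eb \<cdot> (?L \<cdot> FMor T a b)
      = (imap V (Id V (ihom V ?Tk ?Ta)) ?eb \<cdot> ?L) \<cdot> FMor T a b"
    by (rule A.comp_assoc[symmetric], (rule homs)+)
  also have "\<dots> = imap V ?ea (Id V ?Tb) \<cdot> FMor T a b"
    by (simp add: A.eval_at_Lmap[OF x obs(2,3)])
  also have "imap V (FMor T k a) (Id V ?Tb) \<cdot> (imap V ?ea (Id V ?Tb) \<cdot> FMor T a b)
      = (imap V (FMor T k a) (Id V ?Tb) \<cdot> imap V ?ea (Id V ?Tb)) \<cdot> FMor T a b"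
    by (rule A.comp_assoc[symmetric], (rule homs)+)
  also have "\<dots> = imap V (yoneda_component k x a) (Id V ?Tb) \<cdot> FMor T a b"
    by (simp add: yoneda_component_def A.imap_comp_Id[OF obs(3) Tka ea])
  finally show ?thesis .
qed

text \<open>
  Here \<open>t\<close> and \<open>s\<close> are the components \<open>\<theta>\<^sub>k\<close> and \<open>\<theta>\<^sub>a\<close>. Evaluating the naturality square from \<open>k\<close> to \<open>a\<close>
  at \<open>j\<^sub>k\<close> turns one side into the component built from \<open>t \<circ> j\<^sub>k\<close>; on the other side \<open>s\<close> comes out by
  naturality of evaluation, and the unit law of \<open>A\<close> removes the rest.
\<close>

lemma yoneda_component_of_natural:
  assumes k: "k \<in> EOb A" and a: "a \<in> EOb A"
    and tk: "t \<in> hom V (EHom A k k) (FOb T k)" and ta: "s \<in> hom V (EHom A k a) (FOb T a)"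
    and natural: "imap V (Id V (EHom A k k)) s \<cdot> EL A k k a
      = imap V t (Id V (FOb T a)) \<cdot> FMor T k a"
  shows "yoneda_component k (t \<cdot> Ej A k) a = s"
proof -
  let ?H = "EHom A k a" and ?Ta = "FOb T a"
  have obs: "?H \<in> Ob V" "EHom A k k \<in> Ob V" "?Ta \<in> Ob V"
    by (rule k a A.EHom_Ob FOb_Ob)+
  have j: "Ej A k \<in> hom V (unit_ob V) (EHom A k k)"
    using k by (rule A.Ej_in_hom)
  have EL: "EL A k k a \<in> hom V ?H (ihom V (EHom A k k) ?H)"
    using k k a by (rule A.EL_in_hom)
  note homs = obs tk ta EL FMor_in_ihom[OF k a] A.eval_at_in_hom[OF j]
    A.Id_in_hom A.imap_in_hom
  have "yoneda_component k (t \<cdot> Ej A k) a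
      = (eval_at V (Ej A k) ?Ta \<cdot> imap V t (Id V ?Ta)) \<cdot> FMor T k a"
    by (simp add: yoneda_component_def A.eval_at_comp[OF j tk obs(3)])
  also have "\<dots> = eval_at V (Ej A k) ?Ta \<cdot> (imap V t (Id V ?Ta) \<cdot> FMor T k a)"
    by (rule A.comp_assoc, (rule homs)+)
  also have "\<dots> = eval_at V (Ej A k) ?Ta \<cdot> (imap V (Id V (EHom A k k)) s \<cdot> EL A k k a)"
    by (simp add: natural)
  also have "\<dots> = (eval_at V (Ej A k) ?Ta \<cdot> imap V (Id V (EHom A k k)) s) \<cdot> EL A k k a"
    by (rule A.comp_assoc[symmetric], (rule homs)+)
  also have "\<dots> = (s \<cdot> eval_at V (Ej A k) ?H) \<cdot> EL A k k a"
    by (simp add: A.eval_at_natural[OF j ta])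
  also have "\<dots> = s \<cdot> (eval_at V (Ej A k) ?H \<cdot> EL A k k a)"
    by (rule A.comp_assoc, (rule homs)+)
  also have "\<dots> = s"
    by (simp add: A.eval_at_Ej_EL[OF k a] A.comp_Id_right[OF ta])
  finally show ?thesis .
qed

end

section \<open>The weak Yoneda lemma\<close>

theorem theorem9:
  fixes V :: "('o, 'm) skew_closed_cat"
    and A :: "('a, 'o, 'm) enriched_cat"
    and K :: 'a
    and T :: "('a, 'o, 'm) enriched_fun"
  assumes "left_skew_closed_category V"
    and "enriched_category V A"
    and "K \<in> EOb A"
    and "enriched_functor V A (self_enriched V) T"
  shows "bij_betw (\<lambda>\<theta>. \<theta> K \<cdot>\<^bsub>V\<^esub> Ej A K)
    (enriched_nat_trans V A (representable A K) T)
    (hom V (unit_ob V) (FOb T K))"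
proof -
  interpret enriched_functor_to_base V A T
    using assms(4) by (rule enriched_functor_to_base.intro)
  note K = assms(3)
  let ?N = "enriched_nat_trans V A (representable A K) T"
  show ?thesis
  proof (rule bij_betw_byWitness[where f' = "\<lambda>x. restrict (yoneda_component K x) (EOb A)"])
    show "\<forall>\<theta>\<in>?N. restrict (yoneda_component K (\<theta> K \<cdot>\<^bsub>V\<^esub> Ej A K)) (EOb A) = \<theta>"
    proof
      fix \<theta> assume "\<theta> \<in> ?N"
      then have PiE: "\<theta> \<in> (\<Pi>\<^sub>E a\<in>EOb A. hom V (EHom A K a) (FOb T a))"
        and natural: "\<And>a. a \<in> EOb A \<Longrightarrow> imap V (Id V (EHom A K K)) (\<theta> a) \<cdot>\<^bsub>V\<^esub> EL A K K a
          = imap V (\<theta> K) (Id V (FOb T a)) \<cdot>\<^bsub>V\<^esub> FMor T K a"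
        using K by (auto simp: enriched_nat_trans_def representable_def)
      have "yoneda_component K (\<theta> K \<cdot>\<^bsub>V\<^esub> Ej A K) a = \<theta> a" if "a \<in> EOb A" for a
        using K that PiE_mem[OF PiE K] PiE_mem[OF PiE that] natural[OF that]
        by (rule yoneda_component_of_natural)
      then show "restrict (yoneda_component K (\<theta> K \<cdot>\<^bsub>V\<^esub> Ej A K)) (EOb A) = \<theta>"
        by (intro ext) (simp add: PiE_arb[OF PiE])
    qed
    show "\<forall>x\<in>hom V (unit_ob V) (FOb T K).
        restrict (yoneda_component K x) (EOb A) K \<cdot>\<^bsub>V\<^esub> Ej A K = x"
      using K by (simp add: yoneda_component_Ej)
    show "(\<lambda>\<theta>. \<theta> K \<cdot>\<^bsub>V\<^esub> Ej A K) ` ?N \<subseteq> hom V (unit_ob V) (FOb T K)"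
    proof (rule image_subsetI)
      fix \<theta> assume "\<theta> \<in> ?N"
      then have "\<theta> \<in> (\<Pi>\<^sub>E a\<in>EOb A. hom V (EHom A K a) (FOb T a))"
        by (simp add: enriched_nat_trans_def representable_def)
      then have "\<theta> K \<in> hom V (EHom A K K) (FOb T K)"
        using K by (rule PiE_mem)
      then show "\<theta> K \<cdot>\<^bsub>V\<^esub> Ej A K \<in> hom V (unit_ob V) (FOb T K)"
        by (rule A.comp_in_hom[OF A.Ej_in_hom[OF K]])
    qed
    show "(\<lambda>x. restrict (yoneda_component K x) (EOb A)) ` hom V (unit_ob V) (FOb T K) \<subseteq> ?N"
      using K by (auto simp: enriched_nat_trans_def representable_def
          yoneda_component_in_hom yoneda_component_natural)
  qed
qed

end
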